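(* Let $\mathcal I'$ be the left ideal of $\mathcal D$ generated by \begin{align*} P_a&=(1-a)A-1+aZ,\\ P_b&=(1-b)B-1+bZ,\\ P_c&=z(c-b)(c-a)C+(c-1)(c^2+abz-(a+b)cz)-(c-1)c(c-abz)Z,\\ Q_a&=(-cq+ac+aq-a^2z)+a(abz-c)Z+q(c-a)A^{-1},\\ Q_b&=(-cq+bc+bq-b^2z)+b(abz-c)Z+q(c-b)B^{-1},\\ Q_c&=-q+cZ+(q-c)C^{-1},\\ R_z&=-(c+q-az-bz)+(q-z)Z^{-1}+(c-abz)Z. \end{align*} For any three distinct $X_1,X_2,X_3\in N$ there exist non-zero polynomials $p_1,p_2,p_3$ (in $a,b,c,q,z$) such that $p_1X_1+p_2X_2+p_3X_3\in\mathcal I'$. The polynomials $(p_1,p_2,p_3)$ are unique up to (simultaneous) multiplication by elements of $\mathcal R$.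
   Context: $\mathcal R=\mathbb C(a,b,c,q,z)$ is the field of rational functions in $a,b,c,q,z$. $N\cong\mathbb Z^4$ is the abelian group of elements $M_{k_a,k_b,k_c,k_z}$ ($k_a,k_b,k_c,k_z\in\mathbb Z$) acting on functions as $q$-dilations: $M_{k_a,k_b,k_c,k_z}f(a,b,c,q,z)=f(aq^{k_a},bq^{k_b},cq^{k_c},q,zq^{k_z})$, with composition as group law. $A=M_{1,0,0,0}$, $B=M_{0,1,0,0}$, $C=M_{0,0,1,0}$, $Z=M_{0,0,0,1}$ are generators of $N$. The ring of $q$-difference operators is the smash product $\mathcal D=\mathcal R\# N$: its elements are finite sums $\sum_k r_kP_k$ ($r_k\in\mathcal R$, $P_k\in N$), i.e. as a vector space $\mathcal R\otimes_{\mathbb C}\mathbb C[N]$, with multiplication $(\sum_k r_kP_k)(\sum_j s_jQ_j)=\sum_{k,j}r_kP_k(s_j)P_kQ_j$, where $P_k(s_j)$ uses the action of $N$ on $\mathcal R$. *)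

theory Defs
  imports
    Complex_Main
    "HOL-Library.Poly_Mapping"
    "HOL-Library.Product_Plus"
    "HOL-Computational_Algebra.Polynomial_Factorial"
    "HOL-Computational_Algebra.Field_as_Ring"
begin

text \<open>
  Polynomials in five variables are iterated univariate ones, the ring being read as
  C[q][a][b][c][z]: q is the innermost variable and z the outermost one.
\<close>

type_synonym poly5 = "complex poly poly poly poly poly"
type_synonym rat5 = "poly5 fract"

definition const5 :: "complex \<Rightarrow> rat5" where
  "const5 x = to_fract [:[:[:[:[:x:]:]:]:]:]"

definition vq :: rat5 where "vq = to_fract [:[:[:[:[:0, 1:]:]:]:]:]"
definition va :: rat5 where "va = to_fract [:[:[:[:0, 1:]:]:]:]"
definition vb :: rat5 where "vb = to_fract [:[:[:0, 1:]:]:]"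
definition vc :: rat5 where "vc = to_fract [:[:0, 1:]:]"
definition vz :: rat5 where "vz = to_fract [:0, 1:]"

definition eval5 :: "rat5 \<Rightarrow> rat5 \<Rightarrow> rat5 \<Rightarrow> rat5 \<Rightarrow> rat5 \<Rightarrow> poly5 \<Rightarrow> rat5" where
  "eval5 a b c q z p =
     poly (map_poly (\<lambda>pc. poly (map_poly (\<lambda>pb. poly (map_poly (\<lambda>pa. poly (map_poly (\<lambda>pq.
       poly (map_poly const5 pq) q) pa) a) pb) b) pc) c) p) z"

text \<open>
  The quadruple \<open>(ka, kb, kc, kz)\<close> stands for the dilation with these exponents; the group law
  (composition) is the componentwise addition of \<^theory>\<open>HOL-Library.Product_Plus\<close>, and the
  identity is \<open>0\<close>.
\<close>

type_synonym dilation = "int \<times> int \<times> int \<times> int"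

definition dil_A :: dilation where "dil_A = (1, 0, 0, 0)"
definition dil_B :: dilation where "dil_B = (0, 1, 0, 0)"
definition dil_C :: dilation where "dil_C = (0, 0, 1, 0)"
definition dil_Z :: dilation where "dil_Z = (0, 0, 0, 1)"

text \<open>
  The action is substitution into numerator and denominator of the reduced fraction. The
  substitution is injective on polynomials, so that the denominator never becomes zero.
\<close>

definition act :: "dilation \<Rightarrow> rat5 \<Rightarrow> rat5" where
  "act k f = (case k of (ka, kb, kc, kz) \<Rightarrow>
     let ev = eval5 (va * vq powi ka) (vb * vq powi kb) (vc * vq powi kc) vq (vz * vq powi kz)
     in ev (fst (quot_of_fract f)) / ev (snd (quot_of_fract f)))"

text \<open>
  An operator is the finitely supported family of its coefficients with respect to the left basis
  of dilations. The product of the ring is \<open>\<star>\<close> below; the product that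
  \<^theory>\<open>HOL-Library.Poly_Mapping\<close> puts on this type is the one of the untwisted group ring and
  is not used.
\<close>

type_synonym qop = "dilation \<Rightarrow>\<^sub>0 rat5"

abbreviation op_term :: "rat5 \<Rightarrow> dilation \<Rightarrow> qop" (infix "\<cdot>" 75) where
  "r \<cdot> X \<equiv> Poly_Mapping.single X r"

definition qop_mult :: "qop \<Rightarrow> qop \<Rightarrow> qop" (infixl "\<star>" 70) where
  "S \<star> T = (\<Sum>P \<in> Poly_Mapping.keys S. \<Sum>Q \<in> Poly_Mapping.keys T.
     (Poly_Mapping.lookup S P * act P (Poly_Mapping.lookup T Q)) \<cdot> (P + Q))"

definition left_ideal :: "qop set \<Rightarrow> bool" where
  "left_ideal J \<longleftrightarrow> 0 \<in> J \<and> (\<forall>S\<in>J. \<forall>T\<in>J. S + T \<in> J) \<and> (\<forall>S\<in>J. - S \<in> J) \<and>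
     (\<forall>D. \<forall>S\<in>J. D \<star> S \<in> J)"

definition left_ideal_generated :: "qop set \<Rightarrow> qop set" where
  "left_ideal_generated G = \<Inter> {J. left_ideal J \<and> G \<subseteq> J}"

definition gen_Pa :: qop where
  "gen_Pa = (1 - va) \<cdot> dil_A - 1 \<cdot> 0 + va \<cdot> dil_Z"

definition gen_Pb :: qop where
  "gen_Pb = (1 - vb) \<cdot> dil_B - 1 \<cdot> 0 + vb \<cdot> dil_Z"

definition gen_Pc :: qop where
  "gen_Pc = (vz * (vc - vb) * (vc - va)) \<cdot> dil_C
     + ((vc - 1) * (vc^2 + va * vb * vz - (va + vb) * vc * vz)) \<cdot> 0
     - ((vc - 1) * vc * (vc - va * vb * vz)) \<cdot> dil_Z"

definition gen_Qa :: qop where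
  "gen_Qa = (- vc * vq + va * vc + va * vq - va^2 * vz) \<cdot> 0
     + (va * (va * vb * vz - vc)) \<cdot> dil_Z
     + (vq * (vc - va)) \<cdot> (- dil_A)"

definition gen_Qb :: qop where
  "gen_Qb = (- vc * vq + vb * vc + vb * vq - vb^2 * vz) \<cdot> 0
     + (vb * (va * vb * vz - vc)) \<cdot> dil_Z
     + (vq * (vc - vb)) \<cdot> (- dil_B)"

definition gen_Qc :: qop where
  "gen_Qc = (- vq) \<cdot> 0 + vc \<cdot> dil_Z + (vq - vc) \<cdot> (- dil_C)"

definition gen_Rz :: qop where
  "gen_Rz = (- (vc + vq - va * vz - vb * vz)) \<cdot> 0
     + (vq - vz) \<cdot> (- dil_Z)
     + (vc - va * vb * vz) \<cdot> dil_Z"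

definition ideal_I' :: "qop set" where
  "ideal_I' = left_ideal_generated {gen_Pa, gen_Pb, gen_Pc, gen_Qa, gen_Qb, gen_Qc, gen_Rz}"

end

theory Submission
  imports Defs
begin

text \<open>
  Let \<open>V\<close> be the quotient of the ring of operators by the left ideal, a left vector space over the
  field of rational functions. The theorem says that the classes of the dilations lie in a plane and
  that any two of them are independent: three vectors in a plane satisfy a relation, which is unique
  up to a factor and has only non-zero coefficients if the vectors are pairwise independent.
  Clearing denominators makes the coefficients polynomial.

  The classes of \<open>1\<close> and \<open>Z\<close> span \<open>V\<close>. Each generator of the ideal expresses
  one of the dilations \<open>A\<close>, \<open>B\<close>, \<open>C\<close> or the inverse of one of \<open>A\<close>, \<open>B\<close>, \<open>C\<close>, \<open>Z\<close> by \<open>1\<close> and \<open>Z\<close>;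
  the rule for the inverse of \<open>Z\<close>, shifted by \<open>Z\<close>, reduces \<open>Z\<^sup>2\<close>. Because dilations
  commute, these rules can be iterated (\<open>reducible_dilation\<close>).

  That the ideal does not identify more is shown by a model. On the plane with the basis
  \<open>1\<close>, \<open>Z\<close> the rewriting rules prescribe semilinear maps for the generators of the group. They
  commute and are invertible, which amounts to a handful of identities between rational functions, and so
  define an action \<open>rho\<close> of the whole group. The ideal annihilates the vector \<open>1\<close> of this module
  (\<open>ideal_annihilates\<close>).

  Suppose finally that two distinct dilations were dependent modulo the ideal. Then some \<open>W \<noteq> 1\<close>
  would multiply the vector \<open>1\<close> by a rational function \<open>t\<close>, hence the vector \<open>Z\<close> by its dilate
  \<open>Z(t)\<close>. Commuting \<open>W\<close> with the known maps of \<open>A\<close>, \<open>B\<close>, \<open>C\<close> and \<open>Z\<close> determines how \<open>W\<close> moves the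
  ratio of the two coordinates of each of these maps, and comparison with the actual dilates of those
  ratios forces all exponents of \<open>W\<close> to vanish (\<open>scalar_dilation_trivial\<close>).
\<close>

section \<open>Dilations act by field automorphisms\<close>

definition unital_hom :: "('a::comm_ring_1 \<Rightarrow> 'b::comm_ring_1) \<Rightarrow> bool" where
  "unital_hom h \<longleftrightarrow> h 0 = 0 \<and> h 1 = 1 \<and> (\<forall>x y. h (x + y) = h x + h y) \<and> (\<forall>x y. h (x * y) = h x * h y)"

lemma unital_homD:
  assumes "unital_hom h"
  shows "h 0 = 0" "h 1 = 1" "h (x + y) = h x + h y" "h (x * y) = h x * h y"
  using assms by (auto simp: unital_hom_def)

lemma unital_hom_eval:
  assumes h: "unital_hom h"
  shows "unital_hom (\<lambda>p. poly (map_poly h p) x)"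
proof -
  let ?e = "\<lambda>p. poly (map_poly h p) x"
  note hs = unital_homD[OF h]
  have pc: "?e (pCons a p) = h a + x * ?e p" for a p
    by (simp add: map_poly_pCons hs)
  have add: "?e (p + r) = ?e p + ?e r" for p r
    by (induction p r rule: poly_induct2) (simp_all add: pc hs algebra_simps)
  have sm: "?e (smult a p) = h a * ?e p" for a p
    by (induction p) (simp_all add: pc hs algebra_simps)
  have mult: "?e (p * r) = ?e p * ?e r" for p r
    by (induction p) (simp_all add: pc add sm hs algebra_simps)
  show ?thesis
    unfolding unital_hom_def by (simp add: add mult hs)
qed

lemma unital_hom_const5: "unital_hom const5"
  by (auto simp: unital_hom_def const5_def one_pCons simp flip: to_fract_add to_fract_mult to_fract_1)

lemma unital_hom_eval5: "unital_hom (eval5 a b c q z)"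
  unfolding eval5_def by (intro unital_hom_eval unital_hom_const5)

lemma eval5_generators [simp]:
  "eval5 a b c q z [:[:[:[:[:x:]:]:]:]:] = const5 x"
  "eval5 a b c q z [:[:[:[:[:0, 1:]:]:]:]:] = q"
  "eval5 a b c q z [:[:[:[:0, 1:]:]:]:] = a"
  "eval5 a b c q z [:[:[:0, 1:]:]:] = b"
  "eval5 a b c q z [:[:0, 1:]:] = c"
  "eval5 a b c q z [:0, 1:] = z"
  using unital_homD[OF unital_hom_const5]
  by (simp_all add: eval5_def map_poly_pCons one_pCons)

lemma poly_generated_induct:
  fixes p :: "'a::comm_ring_1 poly"
  assumes "\<And>x. P [:x:]" "P [:0, 1:]"
    and "\<And>p r. P p \<Longrightarrow> P r \<Longrightarrow> P (p + r)" "\<And>p r. P p \<Longrightarrow> P r \<Longrightarrow> P (p * r)"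
  shows "P p"
proof (induction p)
  case 0
  show ?case using assms(1)[of 0] by simp
next
  case (pCons x p)
  have "pCons x p = [:x:] + [:0, 1:] * p" by simp
  then show ?case using assms pCons by metis
qed

text \<open>
  Constants and variables generate the ring. The nested coefficient rings are passed through from the
  innermost one outwards, the constants of each level being the polynomials of the level before.
\<close>

lemma poly5_induct:
  fixes p :: poly5
  assumes const: "\<And>x. P [:[:[:[:[:x:]:]:]:]:]"
    and vars: "P [:[:[:[:[:0, 1:]:]:]:]:]" "P [:[:[:[:0, 1:]:]:]:]" "P [:[:[:0, 1:]:]:]" "P [:[:0, 1:]:]" "P [:0, 1:]"
    and add: "\<And>p r. P p \<Longrightarrow> P r \<Longrightarrow> P (p + r)" and mult: "\<And>p r. P p \<Longrightarrow> P r \<Longrightarrow> P (p * r)"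
  shows "P p"
proof -
  have add': "P [:x:] \<Longrightarrow> P [:y:] \<Longrightarrow> P [:x + y:]" for x y using add[of "[:x:]" "[:y:]"] by simp
  have mult': "P [:x:] \<Longrightarrow> P [:y:] \<Longrightarrow> P [:x * y:]" for x y using mult[of "[:x:]" "[:y:]"] by (simp add: mult.commute)
  have 4: "P [:[:[:[:t:]:]:]:]" for t
  proof (induction t rule: poly_generated_induct)
    case (3 p r)
    then show ?case using add'[of "[:[:[:p:]:]:]" "[:[:[:r:]:]:]"] by simp
  next
    case (4 p r)
    then show ?case using mult'[of "[:[:[:p:]:]:]" "[:[:[:r:]:]:]"] by (simp add: mult.commute)
  qed (fact const vars)+
  have 3: "P [:[:[:t:]:]:]" for t
  proof (induction t rule: poly_generated_induct)
    case (3 p r)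
    then show ?case using add'[of "[:[:p:]:]" "[:[:r:]:]"] by simp
  next
    case (4 p r)
    then show ?case using mult'[of "[:[:p:]:]" "[:[:r:]:]"] by (simp add: mult.commute)
  qed (fact 4 vars)+
  have 2: "P [:[:t:]:]" for t
  proof (induction t rule: poly_generated_induct)
    case (3 p r)
    then show ?case using add'[of "[:p:]" "[:r:]"] by simp
  next
    case (4 p r)
    then show ?case using mult'[of "[:p:]" "[:r:]"] by (simp add: mult.commute)
  qed (fact 3 vars)+
  have 1: "P [:t:]" for t
    by (induction t rule: poly_generated_induct) (fact 2 vars add' mult')+
  show ?thesis
    by (induction p rule: poly_generated_induct) (fact 1 vars add mult)+
qed

lemma vars_nonzero [simp]: "vq \<noteq> 0" "va \<noteq> 0" "vb \<noteq> 0" "vc \<noteq> 0" "vz \<noteq> 0"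
  by (simp_all add: vq_def va_def vb_def vc_def vz_def)

definition dilate :: "dilation \<Rightarrow> poly5 \<Rightarrow> rat5" where
  "dilate k = (case k of (ka, kb, kc, kz) \<Rightarrow>
     eval5 (va * vq powi ka) (vb * vq powi kb) (vc * vq powi kc) vq (vz * vq powi kz))"

lemma act_dilate: "act k f = dilate k (fst (quot_of_fract f)) / dilate k (snd (quot_of_fract f))"
  by (simp add: act_def dilate_def Let_def split: prod.split)

lemma unital_hom_dilate: "unital_hom (dilate k)"
  by (cases k) (simp add: dilate_def unital_hom_eval5)

lemmas dilate_hom = unital_homD[OF unital_hom_dilate]

lemma dilate_generators [simp]:
  "dilate k [:[:[:[:[:x:]:]:]:]:] = const5 x"
  "dilate k [:[:[:[:[:0, 1:]:]:]:]:] = vq"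
  "dilate k [:[:[:[:0, 1:]:]:]:] = va * vq powi fst k"
  "dilate k [:[:[:0, 1:]:]:] = vb * vq powi fst (snd k)"
  "dilate k [:[:0, 1:]:] = vc * vq powi fst (snd (snd k))"
  "dilate k [:0, 1:] = vz * vq powi snd (snd (snd k))"
  by (cases k; simp add: dilate_def)+

lemma to_fract_power: "to_fract (x ^ n) = to_fract x ^ n"
  by (induction n) simp_all

text \<open>
  This is where substitution is seen to be injective. The substitution \<open>dilate (- k)\<close> should undo
  \<open>dilate k\<close>, but \<open>dilate k p\<close> is in general no polynomial, because of negative powers of \<open>q\<close>.
  Since \<open>q\<close> is fixed by dilations, it is enough to clear these powers first.
\<close>

lemma dilate_roundtrip:
  "\<exists>n r. dilate k p * vq ^ n = to_fract r \<and> dilate (- k) r = to_fract p * vq ^ n"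
proof (induction p rule: poly5_induct)
  case (1 x)
  have "dilate k [:[:[:[:[:x:]:]:]:]:] * vq ^ 0 = to_fract [:[:[:[:[:x:]:]:]:]:] \<and> dilate (- k) [:[:[:[:[:x:]:]:]:]:] = to_fract [:[:[:[:[:x:]:]:]:]:] * vq ^ 0"
    by (simp add: const5_def)
  then show ?case by blast
next
  case 2
  have "dilate k [:[:[:[:[:0, 1:]:]:]:]:] * vq ^ 0 = to_fract [:[:[:[:[:0, 1:]:]:]:]:] \<and> dilate (- k) [:[:[:[:[:0, 1:]:]:]:]:] = to_fract [:[:[:[:[:0, 1:]:]:]:]:] * vq ^ 0"
    by (simp add: vq_def)
  then show ?case by blast
next
  let ?q = "[:[:[:[:[:0, 1:]:]:]:]:] :: poly5"
  have dp: "dilate l (x ^ n) = dilate l x ^ n" for l x n by (induction n) (simp_all add: dilate_hom)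
  \<comment> \<open>The common part of the four dilated variables: such a variable is multiplied by
    \<open>q\<close> to the power \<open>m\<close>, and only a negative power has to be cleared.\<close>
  have *: "\<exists>n r. to_fract x * vq powi m * vq ^ n = to_fract r \<and> dilate (- k) r = to_fract x * vq ^ n"
    if x: "dilate (- k) x = to_fract x * vq powi (- m)" for x m
  proof (cases "m \<ge> 0")
    case True
    have "to_fract x * vq powi m * vq ^ 0 = to_fract (x * ?q ^ nat m) \<and> dilate (- k) (x * ?q ^ nat m) = to_fract x * vq ^ 0"
      using True by (simp add: to_fract_power dp dilate_hom x flip: vq_def)
        (simp add: power_int_def flip: power_mult_distrib)
    then show ?thesis by blast
  next
    case False
    have "to_fract x * vq powi m * vq ^ nat (-m) = to_fract x \<and> dilate (- k) x = to_fract x * vq ^ nat (-m)"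
      using False by (simp add: x) (simp add: power_int_def field_simps)
    then show ?thesis by blast
  qed
  case 3
  show ?case using *[of "[:[:[:[:0, 1:]:]:]:]" "fst k"] by (simp add: va_def)
  case 4
  show ?case using *[of "[:[:[:0, 1:]:]:]" "fst (snd k)"] by (simp add: vb_def)
  case 5
  show ?case using *[of "[:[:0, 1:]:]" "fst (snd (snd k))"] by (simp add: vc_def)
  case 6
  show ?case using *[of "[:0, 1:]" "snd (snd (snd k))"] by (simp add: vz_def)
  case (7 p r)
  then obtain n u m v where
    "dilate k p * vq ^ n = to_fract u" "dilate (- k) u = to_fract p * vq ^ n"
    "dilate k r * vq ^ m = to_fract v" "dilate (- k) v = to_fract r * vq ^ m" by blast
  then have "dilate k (p + r) * vq ^ (n + m) = to_fract (u * ?q ^ m + v * ?q ^ n) \<and>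
      dilate (- k) (u * ?q ^ m + v * ?q ^ n) = to_fract (p + r) * vq ^ (n + m)"
    by (simp add: dilate_hom to_fract_power dp power_add algebra_simps flip: vq_def)
  then show ?case by blast
next
  case (8 p r)
  then obtain n u m v where
    "dilate k p * vq ^ n = to_fract u" "dilate (- k) u = to_fract p * vq ^ n"
    "dilate k r * vq ^ m = to_fract v" "dilate (- k) v = to_fract r * vq ^ m" by blast
  note uv = this
  have "dilate k (p * r) * vq ^ (n + m) = (dilate k p * vq ^ n) * (dilate k r * vq ^ m)"
    by (simp add: dilate_hom power_add mult_ac)
  also have "\<dots> = to_fract (u * v)" by (simp only: uv to_fract_mult)
  finally have 1: "dilate k (p * r) * vq ^ (n + m) = to_fract (u * v)" .
  have "dilate (- k) (u * v) = (to_fract p * vq ^ n) * (to_fract r * vq ^ m)"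
    by (simp only: dilate_hom uv)
  also have "\<dots> = to_fract (p * r) * vq ^ (n + m)" by (simp add: power_add mult_ac)
  finally have "dilate (- k) (u * v) = to_fract (p * r) * vq ^ (n + m)" .
  with 1 show ?case by blast
qed

lemma dilate_eq_0_iff [simp]: "dilate k p = 0 \<longleftrightarrow> p = 0"
proof
  assume "dilate k p = 0"
  then show "p = 0" using dilate_roundtrip[of k p] by (auto simp: dilate_hom)
qed (simp add: dilate_hom)

lemma act_fraction:
  assumes "d \<noteq> 0"
  shows "act k (to_fract n / to_fract d) = dilate k n / dilate k d"
proof -
  let ?f = "to_fract n / to_fract d"
  obtain u v where uv: "quot_of_fract ?f = (u, v)" by (cases "quot_of_fract ?f")
  have v: "v \<noteq> 0" using snd_quot_of_fract_nonzero[of ?f] uv by simp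
  have "?f = to_fract u / to_fract v" by (metis Fract_conv_to_fract Fract_quot_of_fract fst_conv snd_conv uv)
  with assms v have "to_fract (n * v) = to_fract (u * d)"
    by (simp add: field_simps)
  then have "n * v = u * d" by (simp only: to_fract_eq_iff)
  then have "dilate k n * dilate k v = dilate k u * dilate k d"
    by (metis dilate_hom(4))
  with assms v show ?thesis by (simp add: act_dilate uv field_simps)
qed

lemma act_to_fract: "act k (to_fract p) = dilate k p"
  using act_fraction[of 1 k p] by (simp add: dilate_hom)

lemma fraction_cases:
  obtains n d :: poly5 where "d \<noteq> 0" "(f :: rat5) = to_fract n / to_fract d"
  by (metis Fract_conv_to_fract Fract_quot_of_fract snd_quot_of_fract_nonzero)

lemma unital_hom_act: "unital_hom (act k)"
proof -
  have "act k (f + g) = act k f + act k g \<and> act k (f * g) = act k f * act k g" for f g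
  proof -
    obtain n d n' d' where d: "d \<noteq> 0" "d' \<noteq> 0" and f: "f = to_fract n / to_fract d"
      and g: "g = to_fract n' / to_fract d'" by (metis fraction_cases)
    have "f + g = to_fract (n * d' + n' * d) / to_fract (d * d')" "f * g = to_fract (n * n') / to_fract (d * d')"
      using d by (simp_all add: f g field_simps)
    then have fg: "act k (f + g) = dilate k (n * d' + n' * d) / dilate k (d * d')"
      "act k (f * g) = dilate k (n * n') / dilate k (d * d')"
      using d by (metis act_fraction mult_eq_0_iff)+
    have "act k f = dilate k n / dilate k d" "act k g = dilate k n' / dilate k d'"
      using d f g by (simp_all add: act_fraction)
    with fg show ?thesis using d by (simp only: fg) (simp add: dilate_hom add_frac_eq)
  qed
  moreover have "act k 0 = 0" "act k 1 = 1"
    using act_to_fract[of k 0] act_to_fract[of k 1] by (simp_all add: dilate_hom)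
  ultimately show ?thesis by (simp add: unital_hom_def)
qed

lemmas act_hom [simp] = unital_homD[OF unital_hom_act]

lemma act_minus [simp]: "act k (- f) = - act k f"
  using act_hom(3)[of k f "- f"] by (simp add: add_eq_0_iff del: act_hom(3))

lemma act_diff [simp]: "act k (f - g) = act k f - act k g"
  using act_hom(3)[of k f "- g"] by simp

lemma act_eq_0_iff [simp]: "act k f = 0 \<longleftrightarrow> f = 0"
proof
  assume "act k f = 0"
  moreover have "act k f * act k (inverse f) = 1" if "f \<noteq> 0"
    using that by (simp flip: act_hom(4))
  ultimately show "f = 0" by auto
qed simp

lemma act_inverse [simp]: "act k (inverse f) = inverse (act k f)"
proof (cases "f = 0")
  case False
  then have "act k f * act k (inverse f) = 1" by (simp flip: act_hom(4))
  then show ?thesis by (metis inverse_unique)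
qed simp

lemma act_divide [simp]: "act k (f / g) = act k f / act k g"
  by (simp add: divide_inverse)

lemma act_power [simp]: "act k (f ^ n) = act k f ^ n"
  by (induction n) simp_all

lemma act_power_int [simp]: "act k (f powi n) = act k f powi n"
  by (simp add: power_int_def)

lemma act_const5 [simp]: "act k (const5 x) = const5 x"
  by (metis act_to_fract const5_def dilate_generators(1))

lemma act_vars [simp]:
  "act k vq = vq"
  "act k va = va * vq powi fst k"
  "act k vb = vb * vq powi fst (snd k)"
  "act k vc = vc * vq powi fst (snd (snd k))"
  "act k vz = vz * vq powi snd (snd (snd k))"
  by (simp_all add: vq_def va_def vb_def vc_def vz_def act_to_fract)

text \<open>
  A ring homomorphism on the rational functions is determined by its values on the constants and on
  the variables; both the identity law and the composition law of the action follow from this.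
\<close>

lemma act_eqI:
  assumes h: "unital_hom h" and "\<And>x. h (const5 x) = const5 x" "h vq = vq"
    "h va = va * vq powi fst k"
  "h vb = vb * vq powi fst (snd k)"
  "h vc = vc * vq powi fst (snd (snd k))"
  "h vz = vz * vq powi snd (snd (snd k))"
  shows "h f = act k f"
proof -
  note hs = unital_homD[OF h]
  have *: "h (to_fract p) = act k (to_fract p)" for p
  proof (induction p rule: poly5_induct)
    case (1 x)
    show ?case using assms by (simp flip: const5_def)
  qed (simp_all add: assms hs flip: vq_def va_def vb_def vc_def vz_def)
  obtain n d where d: "d \<noteq> 0" and f: "f = to_fract n / to_fract d" by (metis fraction_cases)
  have "f * to_fract d = to_fract n" using d f by simp
  then have "h f * act k (to_fract d) = act k f * act k (to_fract d)"
    by (metis * hs(4) act_hom(4))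
  then show ?thesis using d by simp
qed

lemma act_0 [simp]: "act 0 f = f"
  by (rule act_eqI[of "\<lambda>f. f", symmetric]) (simp_all add: unital_hom_def)

lemma act_add: "act (k + l) f = act k (act l f)"
  by (rule act_eqI[symmetric]) (simp_all add: unital_hom_def power_int_add mult_ac)

text \<open>
  These inequalities exclude the zeros of the factors that occur in the denominators of the rewriting
  rules and of their dilates, or that cancel when such rules are composed. The monomials
  nested to the right have the form that \<open>algebra_simps\<close> produces, so that the simplifier recognises
  them after denominators have been cleared.
\<close>

lemma denominators_nonzero [simp]:
  "1 \<noteq> va" "1 \<noteq> vb" "1 \<noteq> vc" "1 \<noteq> vq" "1 \<noteq> vz" "va \<noteq> vq" "vb \<noteq> vq" "vq \<noteq> vc" "vq \<noteq> vz"
  "vc \<noteq> va" "vc \<noteq> vb" "vc \<noteq> va * vq" "vc \<noteq> vb * vq"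
  "vc \<noteq> va * vb * vz" "vc \<noteq> va * (vb * vz)" "vc \<noteq> va * (vb * (vq * vz))"
  "vc \<noteq> va * (vb * (vq * (vq * vz)))" "1 \<noteq> va * (vb * (vq * (vq * vz)))"
  by (simp_all add: va_def vb_def vc_def vq_def vz_def one_pCons flip: to_fract_1 to_fract_mult)

declare denominators_nonzero [symmetric, simp]

section \<open>The classes of 1 and Z span the quotient\<close>

lemma lattice_induct [case_names 0 A A' B B' C C' Z Z']:
  fixes k :: dilation
  assumes "P 0"
    and "\<And>k. P k \<Longrightarrow> P (dil_A + k)" "\<And>k. P k \<Longrightarrow> P (k - dil_A)"
    and "\<And>k. P k \<Longrightarrow> P (dil_B + k)" "\<And>k. P k \<Longrightarrow> P (k - dil_B)"
    and "\<And>k. P k \<Longrightarrow> P (dil_C + k)" "\<And>k. P k \<Longrightarrow> P (k - dil_C)"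
    and "\<And>k. P k \<Longrightarrow> P (dil_Z + k)" "\<And>k. P k \<Longrightarrow> P (k - dil_Z)"
  shows "P k"
proof -
  have line: "P (k + scale m)" if "P k" and "scale 0 = 0"
    and "\<And>m. scale (m + 1) = g + scale m" "\<And>m. scale (m - 1) = scale m - g"
    and "\<And>k. P k \<Longrightarrow> P (g + k)" "\<And>k. P k \<Longrightarrow> P (k - g)"
    for k g m and scale :: "int \<Rightarrow> dilation"
    using that by (induction m rule: int_induct[of _ 0]) (simp_all add: add.left_commute add_diff_eq)
  obtain ka kb kc kz where k: "k = (ka, kb, kc, kz)" by (cases k)
  have "P (0 + (ka, 0, 0, 0))"
    by (rule line[where scale = "\<lambda>m. (m, 0, 0, 0)" and g = dil_A])
      (use assms in \<open>simp_all add: dil_A_def zero_prod_def\<close>)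
  then have "P (0 + (ka, 0, 0, 0) + (0, kb, 0, 0))"
    by (rule line[where scale = "\<lambda>m. (0, m, 0, 0)" and g = dil_B])
      (use assms in \<open>simp_all add: dil_B_def zero_prod_def\<close>)
  then have "P (0 + (ka, 0, 0, 0) + (0, kb, 0, 0) + (0, 0, kc, 0))"
    by (rule line[where scale = "\<lambda>m. (0, 0, m, 0)" and g = dil_C])
      (use assms in \<open>simp_all add: dil_C_def zero_prod_def\<close>)
  then have "P (0 + (ka, 0, 0, 0) + (0, kb, 0, 0) + (0, 0, kc, 0) + (0, 0, 0, kz))"
    by (rule line[where scale = "\<lambda>m. (0, 0, 0, m)" and g = dil_Z])
      (use assms in \<open>simp_all add: dil_Z_def zero_prod_def\<close>)
  then show ?thesis by (simp add: k zero_prod_def)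
qed

text \<open>
  Operators with the identity dilation are kept in the form \<open>r \<cdot> 0\<close>, on which the product rules act.
\<close>

declare single_one [simp del]

lemma qop_mult_add_right: "S \<star> (T + T') = S \<star> T + S \<star> T'"
proof -
  have "(\<Sum>Q\<in>Poly_Mapping.keys (T + T'). (r * act P (Poly_Mapping.lookup (T + T') Q)) \<cdot> (P + Q)) =
    (\<Sum>Q\<in>Poly_Mapping.keys T. (r * act P (Poly_Mapping.lookup T Q)) \<cdot> (P + Q)) +
    (\<Sum>Q\<in>Poly_Mapping.keys T'. (r * act P (Poly_Mapping.lookup T' Q)) \<cdot> (P + Q))" for r P
    by (rule setsum_keys_plus_distrib) (simp_all add: distrib_left single_add)
  then show ?thesis by (simp add: qop_mult_def sum.distrib)
qed

lemma qop_mult_single: "(r \<cdot> P) \<star> (s \<cdot> Q) = (r * act P s) \<cdot> (P + Q)"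
  by (simp add: qop_mult_def)

lemma qop_mult_diff_right: "S \<star> (T - T') = S \<star> T - S \<star> T'"
  using qop_mult_add_right[of S "T - T'" T'] by simp

lemma ideal_I'_least: "S \<in> ideal_I' \<Longrightarrow> left_ideal J \<Longrightarrow>
  {gen_Pa, gen_Pb, gen_Pc, gen_Qa, gen_Qb, gen_Qc, gen_Rz} \<subseteq> J \<Longrightarrow> S \<in> J"
  unfolding ideal_I'_def left_ideal_generated_def by blast

lemma left_ideal_I': "left_ideal ideal_I'"
  unfolding ideal_I'_def left_ideal_generated_def left_ideal_def by blast

lemma ideal_generators:
  "gen_Pa \<in> ideal_I'" "gen_Pb \<in> ideal_I'" "gen_Pc \<in> ideal_I'" "gen_Qa \<in> ideal_I'"
  "gen_Qb \<in> ideal_I'" "gen_Qc \<in> ideal_I'" "gen_Rz \<in> ideal_I'"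
  unfolding ideal_I'_def left_ideal_generated_def by blast+

lemma ideal_closed:
  shows "0 \<in> ideal_I'" "S \<in> ideal_I' \<Longrightarrow> T \<in> ideal_I' \<Longrightarrow> S + T \<in> ideal_I'"
    "S \<in> ideal_I' \<Longrightarrow> - S \<in> ideal_I'"
    "S \<in> ideal_I' \<Longrightarrow> D \<star> S \<in> ideal_I'"
  using left_ideal_I' by (auto simp: left_ideal_def)

lemma ideal_diff: "S \<in> ideal_I' \<Longrightarrow> T \<in> ideal_I' \<Longrightarrow> S - T \<in> ideal_I'"
  using ideal_closed(2)[of S "- T"] ideal_closed(3)[of T] by simp

text \<open>
  The classes of \<open>1\<close> and \<open>Z\<close> span the quotient by the ideal as a left vector space
  because every dilation is reducible.
\<close>

definition reducible :: "qop \<Rightarrow> bool" where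
  "reducible S \<longleftrightarrow> (\<exists>r s. S - (r \<cdot> 0 + s \<cdot> dil_Z) \<in> ideal_I')"

lemma reducible_basis [simp]: "reducible (r \<cdot> 0)" "reducible (r \<cdot> dil_Z)"
proof -
  show "reducible (r \<cdot> 0)" unfolding reducible_def
    by (rule exI[of _ r], rule exI[of _ 0]) (simp add: ideal_closed)
  show "reducible (r \<cdot> dil_Z)" unfolding reducible_def
    by (rule exI[of _ 0], rule exI[of _ r]) (simp add: ideal_closed)
qed

lemma reducible_add: "reducible S \<Longrightarrow> reducible T \<Longrightarrow> reducible (S + T)"
proof -
  assume "reducible S" "reducible T"
  then obtain r s r' s' where "S - (r \<cdot> 0 + s \<cdot> dil_Z) \<in> ideal_I'" "T - (r' \<cdot> 0 + s' \<cdot> dil_Z) \<in> ideal_I'"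
    unfolding reducible_def by blast
  then have "S - (r \<cdot> 0 + s \<cdot> dil_Z) + (T - (r' \<cdot> 0 + s' \<cdot> dil_Z)) \<in> ideal_I'"
    by (rule ideal_closed(2))
  then have "S + T - ((r + r') \<cdot> 0 + (s + s') \<cdot> dil_Z) \<in> ideal_I'"
    by (simp add: single_add algebra_simps)
  then show ?thesis unfolding reducible_def by blast
qed

lemma reducible_cong: "S - T \<in> ideal_I' \<Longrightarrow> reducible T \<Longrightarrow> reducible S"
proof -
  assume ST: "S - T \<in> ideal_I'" and "reducible T"
  then obtain r s where "T - (r \<cdot> 0 + s \<cdot> dil_Z) \<in> ideal_I'" unfolding reducible_def by blast
  from ideal_closed(2)[OF ST this] have "S - (r \<cdot> 0 + s \<cdot> dil_Z) \<in> ideal_I'"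
    by (simp add: algebra_simps)
  then show ?thesis unfolding reducible_def by blast
qed

lemma reducible_scale: "reducible S \<Longrightarrow> reducible ((t \<cdot> 0) \<star> S)"
proof -
  assume "reducible S"
  then obtain r s where *: "S - (r \<cdot> 0 + s \<cdot> dil_Z) \<in> ideal_I'" unfolding reducible_def by blast
  from ideal_closed(4)[OF *, of "t \<cdot> 0"]
  have "(t \<cdot> 0) \<star> S - ((t * r) \<cdot> 0 + (t * s) \<cdot> dil_Z) \<in> ideal_I'"
    by (simp add: qop_mult_diff_right qop_mult_add_right qop_mult_single)
  then show ?thesis unfolding reducible_def by blast
qed

lemma reducible_coeff: "reducible (1 \<cdot> X) \<Longrightarrow> reducible (t \<cdot> X)"
  using reducible_scale[of "1 \<cdot> X" t] by (simp add: qop_mult_single)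

text \<open>
  By \<open>X r = X(r) X\<close>, multiplying \<open>r + s Z\<close> by \<open>X\<close> from the left produces only the two dilations
  \<open>X\<close> and \<open>X Z\<close>.
\<close>

lemma reducible_left_mult:
  assumes "reducible S" "reducible (1 \<cdot> X)" "reducible (1 \<cdot> (X + dil_Z))"
  shows "reducible ((1 \<cdot> X) \<star> S)"
proof -
  from assms(1) obtain r s where "S - (r \<cdot> 0 + s \<cdot> dil_Z) \<in> ideal_I'" unfolding reducible_def by blast
  from ideal_closed(4)[OF this, of "1 \<cdot> X"]
  have "(1 \<cdot> X) \<star> S - (act X r \<cdot> X + act X s \<cdot> (X + dil_Z)) \<in> ideal_I'"
    by (simp add: qop_mult_diff_right qop_mult_add_right qop_mult_single)
  then show ?thesis
    by (rule reducible_cong) (intro reducible_add reducible_coeff[OF assms(2)] reducible_coeff[OF assms(3)])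
qed

lemma reducible_solve:
  assumes "t \<cdot> X + r \<cdot> 0 + s \<cdot> dil_Z \<in> ideal_I'" and t: "t \<noteq> 0"
  shows "reducible (1 \<cdot> X)"
proof -
  have "(inverse t \<cdot> 0) \<star> (t \<cdot> X + r \<cdot> 0 + s \<cdot> dil_Z) \<in> ideal_I'"
    by (rule ideal_closed(4)[OF assms(1)])
  then have "1 \<cdot> X - ((- inverse t * r) \<cdot> 0 + (- inverse t * s) \<cdot> dil_Z) \<in> ideal_I'"
    using t by (simp add: qop_mult_add_right qop_mult_single single_uminus algebra_simps)
  then show ?thesis unfolding reducible_def by blast
qed

lemma reducible_dil_Z_inv: "reducible (1 \<cdot> (- dil_Z))"
proof (rule reducible_solve)
  show "(vq - vz) \<cdot> (- dil_Z) + (- (vc + vq - va * vz - vb * vz)) \<cdot> 0 + (vc - va * vb * vz) \<cdot> dil_Z \<in> ideal_I'"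
    using ideal_generators(7) by (simp add: gen_Rz_def add_ac)
qed simp

text \<open>
  Multiplied by \<open>Z\<close>, the generator \<open>R_z\<close> becomes a relation between \<open>1\<close>, \<open>Z\<close> and \<open>Z\<^sup>2\<close>.
\<close>

lemma reducible_dil_Z_square: "reducible (1 \<cdot> (dil_Z + dil_Z))"
proof (rule reducible_solve)
  have "(1 \<cdot> dil_Z) \<star> gen_Rz \<in> ideal_I'" by (intro ideal_closed ideal_generators)
  then show "(vc - va * vb * vq * vz) \<cdot> (dil_Z + dil_Z) + (vq - vq * vz) \<cdot> 0
       + (- (vc + vq - va * vz * vq - vb * vz * vq)) \<cdot> dil_Z \<in> ideal_I'"
    by (simp add: gen_Rz_def qop_mult_add_right qop_mult_single add_ac mult_ac dil_Z_def zero_prod_def)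
qed (simp add: mult.assoc)

lemma reducible_shift_Z:
  assumes "reducible S"
  shows "reducible ((1 \<cdot> dil_Z) \<star> S)" "reducible ((1 \<cdot> (- dil_Z)) \<star> S)"
proof -
  show "reducible ((1 \<cdot> dil_Z) \<star> S)"
    by (rule reducible_left_mult[OF assms reducible_basis(2) reducible_dil_Z_square])
  have "reducible (1 \<cdot> (- dil_Z + dil_Z))" by simp
  then show "reducible ((1 \<cdot> (- dil_Z)) \<star> S)"
    by (rule reducible_left_mult[OF assms reducible_dil_Z_inv])
qed

text \<open>
  Left multiplication by a reducible dilation \<open>X\<close> preserves reducibility: dilations commute, so \<open>X Z = Z X\<close>,
  and this is reducible because left multiplication by \<open>Z\<close> is already under control. Hence it is
  enough to reduce the generators of the group and their inverses.
\<close>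

lemma reducible_shift:
  assumes "reducible (1 \<cdot> X)" "reducible (1 \<cdot> W)"
  shows "reducible (1 \<cdot> (X + W))"
proof -
  have "reducible (1 \<cdot> (X + dil_Z))"
    using reducible_shift_Z(1)[OF assms(1)] by (simp add: qop_mult_single add.commute)
  from reducible_left_mult[OF assms(2,1) this] show ?thesis by (simp add: qop_mult_single)
qed

lemma reducible_generator_dilations:
  "reducible (1 \<cdot> dil_A)" "reducible (1 \<cdot> dil_B)" "reducible (1 \<cdot> dil_C)"
  "reducible (1 \<cdot> (- dil_A))" "reducible (1 \<cdot> (- dil_B))" "reducible (1 \<cdot> (- dil_C))"
  subgoal
    by (rule reducible_solve[of _ "1 - va" "-1" va])
      (use ideal_generators(1) in \<open>simp only: gen_Pa_def single_uminus diff_conv_add_uminus add_ac\<close>, simp)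
  subgoal
    by (rule reducible_solve[of _ "1 - vb" "-1" vb])
      (use ideal_generators(2) in \<open>simp only: gen_Pb_def single_uminus diff_conv_add_uminus add_ac\<close>, simp)
  subgoal
    by (rule reducible_solve[of _ "vz * (vc - vb) * (vc - va)"
          "(vc - 1) * (vc^2 + va * vb * vz - (va + vb) * vc * vz)"
          "- ((vc - 1) * vc * (vc - va * vb * vz))"])
      (use ideal_generators(3) in \<open>simp only: gen_Pc_def single_uminus diff_conv_add_uminus add_ac\<close>, simp)
  subgoal
    by (rule reducible_solve[of _ "vq * (vc - va)" "- vc * vq + va * vc + va * vq - va^2 * vz"
          "va * (va * vb * vz - vc)"])
      (use ideal_generators(4) in \<open>simp only: gen_Qa_def single_uminus diff_conv_add_uminus add_ac\<close>, simp)
  subgoal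
    by (rule reducible_solve[of _ "vq * (vc - vb)" "- vc * vq + vb * vc + vb * vq - vb^2 * vz"
          "vb * (va * vb * vz - vc)"])
      (use ideal_generators(5) in \<open>simp only: gen_Qb_def single_uminus diff_conv_add_uminus add_ac\<close>, simp)
  subgoal
    by (rule reducible_solve[of _ "vq - vc" "- vq" vc])
      (use ideal_generators(6) in \<open>simp only: gen_Qc_def single_uminus diff_conv_add_uminus add_ac\<close>, simp)
  done

lemma reducible_dilation: "reducible (1 \<cdot> X)"
proof (induction X rule: lattice_induct)
  case (Z' k)
  then show ?case using reducible_shift[OF reducible_dil_Z_inv Z'] by simp
next
  case (A' k)
  then show ?case using reducible_shift[OF reducible_generator_dilations(4) A'] by simp
next
  case (B' k)
  then show ?case using reducible_shift[OF reducible_generator_dilations(5) B'] by simp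
next
  case (C' k)
  then show ?case using reducible_shift[OF reducible_generator_dilations(6) C'] by simp
qed (intro reducible_basis reducible_shift reducible_generator_dilations; assumption)+

section \<open>A two-dimensional module annihilated by the ideal\<close>

text \<open>
  The pair \<open>(r, s)\<close> stands for the class of \<open>r + s Z\<close>; in particular \<open>(1, 0)\<close> is the class of the
  identity and \<open>(0, 1)\<close> the class of \<open>Z\<close>. A left module over the ring of operators with this
  underlying space is the same as an action of the dilations by semilinear maps.
\<close>

type_synonym vec2 = "rat5 \<times> rat5"

definition scale :: "rat5 \<Rightarrow> vec2 \<Rightarrow> vec2" where
  "scale r u = (r * fst u, r * snd u)"

definition semilinear :: "dilation \<Rightarrow> (vec2 \<Rightarrow> vec2) \<Rightarrow> bool" where
  "semilinear k T \<longleftrightarrow> (\<forall>u w. T (u + w) = T u + T w) \<and> (\<forall>r u. T (scale r u) = scale (act k r) (T u))"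

text \<open>
  The semilinear map that sends the basis vectors \<open>(1, 0)\<close> and \<open>(0, 1)\<close> to \<open>x\<close> and \<open>y\<close>.
\<close>

definition twisted_map :: "dilation \<Rightarrow> vec2 \<Rightarrow> vec2 \<Rightarrow> vec2 \<Rightarrow> vec2" where
  "twisted_map k x y u = scale (act k (fst u)) x + scale (act k (snd u)) y"

lemma scale_simps [simp]: "scale r (x, y) = (r * x, r * y)" "scale 0 u = 0" "scale 1 u = u" "scale r 0 = 0"
  by (simp_all add: scale_def zero_prod_def)

lemma scale_add: "scale (r + s) u = scale r u + scale s u" "scale r (u + w) = scale r u + scale r w"
  by (cases u; cases w; simp add: algebra_simps)+

lemma scale_scale: "scale r (scale s u) = scale (r * s) u"
  by (cases u) (simp add: mult.assoc)

lemma semilinear_add: "semilinear k T \<Longrightarrow> T (u + w) = T u + T w"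
  and semilinear_scale: "semilinear k T \<Longrightarrow> T (scale r u) = scale (act k r) (T u)"
  unfolding semilinear_def by blast+

lemma semilinear_twisted_map: "semilinear k (twisted_map k x y)"
  unfolding semilinear_def twisted_map_def
  by (auto simp: scale_add scale_scale)

lemma semilinear_comp: "semilinear k S \<Longrightarrow> semilinear l T \<Longrightarrow> semilinear (k + l) (S \<circ> T)"
  unfolding semilinear_def comp_def act_add by metis

lemma semilinear_id: "semilinear 0 id"
  unfolding semilinear_def by simp

lemma semilinear_eqI:
  assumes S: "semilinear k S" and T: "semilinear k T" and "S (1, 0) = T (1, 0)" "S (0, 1) = T (0, 1)"
  shows "S = T"
proof
  fix u
  have u: "u = scale (fst u) (1, 0) + scale (snd u) (0, 1)" by (cases u) simp
  show "S u = T u"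
    by (subst (1 2) u) (simp only: semilinear_add[OF S] semilinear_add[OF T]
        semilinear_scale[OF S] semilinear_scale[OF T] assms)
qed

text \<open>
  The maps by which the generators and their inverses act are forced by the requirement that the
  module be annihilated by the ideal. The image of \<open>(0, 1)\<close> under \<open>T_Z\<close> is \<open>Z\<^sup>2\<close>, reduced by
  the relation \<open>Z R_z\<close>; a prime marks the map of the inverse dilation.
\<close>

definition T_Z :: "vec2 \<Rightarrow> vec2" where
  "T_Z = twisted_map dil_Z (0, 1)
     ((vq * vz - vq) / (vc - va * vb * vq * vz),
      (vc + vq - (va + vb) * vq * vz) / (vc - va * vb * vq * vz))"

definition T_Z' :: "vec2 \<Rightarrow> vec2" where
  "T_Z' = twisted_map (- dil_Z)
     ((vc + vq - va * vz - vb * vz) / (vq - vz), (va * vb * vz - vc) / (vq - vz)) (1, 0)"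

text \<open>
  Since dilations commute, the image of \<open>Z\<close> has to be \<open>T_Z\<close> of the image \<open>x\<close> of the identity. The
  vector \<open>x\<close> is read off from one of the other six generators of the ideal.
\<close>

definition Z_commuting_map :: "dilation \<Rightarrow> vec2 \<Rightarrow> vec2 \<Rightarrow> vec2" where
  "Z_commuting_map k x = twisted_map k x (T_Z x)"

definition T_A where "T_A = Z_commuting_map dil_A (1 / (1 - va), - va / (1 - va))"
definition T_B where "T_B = Z_commuting_map dil_B (1 / (1 - vb), - vb / (1 - vb))"
definition T_C where "T_C = Z_commuting_map dil_C
  ((1 - vc) * (vc^2 + va * vb * vz - (va + vb) * vc * vz) / (vz * (vc - vb) * (vc - va)),
   (vc - 1) * vc * (vc - va * vb * vz) / (vz * (vc - vb) * (vc - va)))"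
definition T_A' where "T_A' = Z_commuting_map (- dil_A)
  ((vc * vq - va * vc - va * vq + va^2 * vz) / (vq * (vc - va)),
   va * (vc - va * vb * vz) / (vq * (vc - va)))"
definition T_B' where "T_B' = Z_commuting_map (- dil_B)
  ((vc * vq - vb * vc - vb * vq + vb^2 * vz) / (vq * (vc - vb)),
   vb * (vc - va * vb * vz) / (vq * (vc - vb)))"
definition T_C' where "T_C' = Z_commuting_map (- dil_C) (vq / (vq - vc), - vc / (vq - vc))"

lemma T_semilinear:
  "semilinear dil_A T_A" "semilinear dil_B T_B" "semilinear dil_C T_C" "semilinear dil_Z T_Z"
  "semilinear (- dil_A) T_A'" "semilinear (- dil_B) T_B'" "semilinear (- dil_C) T_C'" "semilinear (- dil_Z) T_Z'"
  by (simp_all add: T_A_def T_B_def T_C_def T_Z_def T_A'_def T_B'_def T_C'_def T_Z'_def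
    Z_commuting_map_def semilinear_twisted_map)

lemma twisted_map_base [simp]: "twisted_map k x y (1, 0) = x" "twisted_map k x y (0, 1) = y"
  by (simp_all add: twisted_map_def)

lemma T_Z_base [simp]: "T_Z (1, 0) = (0, 1)" by (simp add: T_Z_def)

lemma Z_commuting_map_base [simp]:
  "Z_commuting_map k x (1, 0) = x" "Z_commuting_map k x (0, 1) = T_Z x"
  by (simp_all add: Z_commuting_map_def)

lemma semilinear_Z_commuting_map: "semilinear k (Z_commuting_map k x)"
  by (simp add: Z_commuting_map_def semilinear_twisted_map)

text \<open>
  On \<open>(1, 0)\<close> the two maps commute by construction, which leaves one equation.
\<close>

lemma Z_commuting_mapI:
  assumes "Z_commuting_map k x (T_Z (0, 1)) = T_Z (T_Z x)"
  shows "Z_commuting_map k x \<circ> T_Z = T_Z \<circ> Z_commuting_map k x"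
proof (rule semilinear_eqI)
  show "semilinear (k + dil_Z) (Z_commuting_map k x \<circ> T_Z)"
    by (intro semilinear_comp T_semilinear semilinear_Z_commuting_map)
  show "semilinear (k + dil_Z) (T_Z \<circ> Z_commuting_map k x)"
    by (subst add.commute) (intro semilinear_comp T_semilinear semilinear_Z_commuting_map)
qed (use assms in simp_all)

lemma dil_components [simp]:
  "fst dil_A = 1" "fst (snd dil_A) = 0" "fst (snd (snd dil_A)) = 0" "snd (snd (snd dil_A)) = 0"
  "fst dil_B = 0" "fst (snd dil_B) = 1" "fst (snd (snd dil_B)) = 0" "snd (snd (snd dil_B)) = 0"
  "fst dil_C = 0" "fst (snd dil_C) = 0" "fst (snd (snd dil_C)) = 1" "snd (snd (snd dil_C)) = 0"
  "fst dil_Z = 0" "fst (snd dil_Z) = 0" "fst (snd (snd dil_Z)) = 0" "snd (snd (snd dil_Z)) = 1"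
  by (simp_all add: dil_A_def dil_B_def dil_C_def dil_Z_def)

text \<open>
  The vector \<open>(1, 0)\<close> generates the whole space under \<open>T_Z\<close>, so that identities between maps that
  commute with \<open>T_Z\<close> have to be checked on this vector only.
\<close>

lemma semilinear_eq_by_T_Z:
  assumes "semilinear k S" "semilinear k T" "S \<circ> T_Z = T_Z \<circ> S" "T \<circ> T_Z = T_Z \<circ> T" "S (1, 0) = T (1, 0)"
  shows "S = T"
proof (rule semilinear_eqI[OF assms(1,2,5)])
  show "S (0, 1) = T (0, 1)"
    using fun_cong[OF assms(3), of "(1, 0)"] fun_cong[OF assms(4), of "(1, 0)"] assms(5) by simp
qed

lemmas T_expand = Z_commuting_map_def T_Z_def twisted_map_def power_int_minus

text \<open>
  Here and in the next two lemmas lies the compatibility of the generators of the ideal: identities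
  between rational functions, verified by clearing denominators.
\<close>

lemma T_commute_Z:
  "T_A \<circ> T_Z = T_Z \<circ> T_A"
  "T_B \<circ> T_Z = T_Z \<circ> T_B"
  "T_C \<circ> T_Z = T_Z \<circ> T_C"
  "T_A' \<circ> T_Z = T_Z \<circ> T_A'"
  "T_B' \<circ> T_Z = T_Z \<circ> T_B'"
  "T_C' \<circ> T_Z = T_Z \<circ> T_C'"
  unfolding T_A_def T_B_def T_C_def T_A'_def T_B'_def T_C'_def
  by (rule Z_commuting_mapI; simp add: T_expand; simp add: divide_simps;
      simp add: algebra_simps power2_eq_square)+

text \<open>
  Commutation with \<open>C\<close> is checked for the inverse of \<open>C\<close>, whose matrix is much simpler; it passes to
  \<open>C\<close> because commuting with a bijection and with its inverse is the same.
\<close>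

lemma T_commute_base:
  "(T_A \<circ> T_B) (1, 0) = (T_B \<circ> T_A) (1, 0)"
  "(T_A \<circ> T_C') (1, 0) = (T_C' \<circ> T_A) (1, 0)"
  "(T_B \<circ> T_C') (1, 0) = (T_C' \<circ> T_B) (1, 0)"
  unfolding T_A_def T_B_def T_C'_def
  by (simp add: T_expand; simp add: divide_simps; simp add: algebra_simps power2_eq_square)+

lemma T_inverse_base:
  "(T_A \<circ> T_A') (1, 0) = (1, 0)" "(T_A' \<circ> T_A) (1, 0) = (1, 0)"
  "(T_B \<circ> T_B') (1, 0) = (1, 0)" "(T_B' \<circ> T_B) (1, 0) = (1, 0)"
  "(T_C \<circ> T_C') (1, 0) = (1, 0)" "(T_C' \<circ> T_C) (1, 0) = (1, 0)"
  unfolding T_A_def T_B_def T_C_def T_A'_def T_B'_def T_C'_def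
  by (simp add: T_expand; simp add: divide_simps; simp add: algebra_simps power2_eq_square)+

lemma T_Z_inverse: "T_Z \<circ> T_Z' = id" "T_Z' \<circ> T_Z = id"
proof -
  have base: "(T_Z \<circ> T_Z') (1, 0) = (1, 0)" "(T_Z' \<circ> T_Z) (0, 1) = (0, 1)"
    unfolding T_Z'_def
    by (simp add: T_expand; simp add: divide_simps; simp add: algebra_simps)+
  have "semilinear 0 (T_Z \<circ> T_Z')" "semilinear 0 (T_Z' \<circ> T_Z)"
    using semilinear_comp[OF T_semilinear(4,8)] semilinear_comp[OF T_semilinear(8,4)] by simp_all
  then show "T_Z \<circ> T_Z' = id" "T_Z' \<circ> T_Z = id"
    using base by (auto intro!: semilinear_eqI[OF _ semilinear_id] simp: T_Z'_def)
qed

lemma T_inverse: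
  "T_A \<circ> T_A' = id" "T_A' \<circ> T_A = id" "T_B \<circ> T_B' = id" "T_B' \<circ> T_B = id"
  "T_C \<circ> T_C' = id" "T_C' \<circ> T_C = id"
proof -
  have *: "S \<circ> T = id" if "semilinear k S" "semilinear (- k) T" "S \<circ> T_Z = T_Z \<circ> S" "T \<circ> T_Z = T_Z \<circ> T"
    "(S \<circ> T) (1, 0) = (1, 0)" for k S T
  proof (rule semilinear_eq_by_T_Z[OF _ semilinear_id])
    show "semilinear 0 (S \<circ> T)" using semilinear_comp[OF that(1,2)] by simp
    show "S \<circ> T \<circ> T_Z = T_Z \<circ> (S \<circ> T)" using that(3,4) by (simp add: fun_eq_iff del: split_paired_All)
  qed (use that(5) in simp_all)
  show "T_A \<circ> T_A' = id" by (rule *[OF T_semilinear(1,5) T_commute_Z(1,4) T_inverse_base(1)])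
  show "T_A' \<circ> T_A = id"
    by (rule *[OF T_semilinear(5) _ T_commute_Z(4,1) T_inverse_base(2)]) (simp add: T_semilinear)
  show "T_B \<circ> T_B' = id" by (rule *[OF T_semilinear(2,6) T_commute_Z(2,5) T_inverse_base(3)])
  show "T_B' \<circ> T_B = id"
    by (rule *[OF T_semilinear(6) _ T_commute_Z(5,2) T_inverse_base(4)]) (simp add: T_semilinear)
  show "T_C \<circ> T_C' = id" by (rule *[OF T_semilinear(3,7) T_commute_Z(3,6) T_inverse_base(5)])
  show "T_C' \<circ> T_C = id"
    by (rule *[OF T_semilinear(7) _ T_commute_Z(6,3) T_inverse_base(6)]) (simp add: T_semilinear)
qed

lemma T_commute: "T_A \<circ> T_B = T_B \<circ> T_A" "T_A \<circ> T_C' = T_C' \<circ> T_A" "T_B \<circ> T_C' = T_C' \<circ> T_B"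
proof -
  have *: "S \<circ> T = T \<circ> S" if "semilinear k S" "semilinear l T" "S \<circ> T_Z = T_Z \<circ> S" "T \<circ> T_Z = T_Z \<circ> T"
    "(S \<circ> T) (1, 0) = (T \<circ> S) (1, 0)" for k l S T
  proof (rule semilinear_eq_by_T_Z)
    show "semilinear (k + l) (S \<circ> T)" by (rule semilinear_comp[OF that(1,2)])
    show "semilinear (k + l) (T \<circ> S)" using semilinear_comp[OF that(2,1)] by (simp add: add.commute)
    show "(S \<circ> T) (1, 0) = (T \<circ> S) (1, 0)" by (rule that(5))
    show "S \<circ> T \<circ> T_Z = T_Z \<circ> (S \<circ> T)" "T \<circ> S \<circ> T_Z = T_Z \<circ> (T \<circ> S)"
      using that(3,4) by (simp_all add: fun_eq_iff del: split_paired_All)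
  qed
  show "T_A \<circ> T_B = T_B \<circ> T_A" by (rule *[OF T_semilinear(1,2) T_commute_Z(1,2) T_commute_base(1)])
  show "T_A \<circ> T_C' = T_C' \<circ> T_A" by (rule *[OF T_semilinear(1,7) T_commute_Z(1,6) T_commute_base(2)])
  show "T_B \<circ> T_C' = T_C' \<circ> T_B" by (rule *[OF T_semilinear(2,7) T_commute_Z(2,6) T_commute_base(3)])
qed

text \<open>
  Integer powers of a bijection \<open>T\<close> with the inverse \<open>T'\<close>.
\<close>

definition iterate :: "('a \<Rightarrow> 'a) \<Rightarrow> ('a \<Rightarrow> 'a) \<Rightarrow> int \<Rightarrow> 'a \<Rightarrow> 'a" where
  "iterate T T' n = (if 0 \<le> n then T ^^ nat n else T' ^^ nat (- n))"

lemma iterate_0 [simp]: "iterate T T' 0 = id"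
  by (simp add: iterate_def)

lemma iterate_1 [simp]: "iterate T T' 1 = T"
  by (simp add: iterate_def)

lemma iterate_add_1:
  assumes "T \<circ> T' = id" shows "iterate T T' (1 + n) = T \<circ> iterate T T' n"
proof (cases "0 \<le> n")
  case True
  then have "nat (1 + n) = Suc (nat n)" by simp
  with True show ?thesis by (simp add: iterate_def)
next
  case False
  then have n: "nat (- n) = Suc (nat (- (1 + n)))" by simp
  then have "T \<circ> iterate T T' n = T \<circ> (T' \<circ> T' ^^ nat (- (1 + n)))" using False n by (simp add: iterate_def)
  also have "\<dots> = T' ^^ nat (- (1 + n))" using assms by (simp add: fun_eq_iff)
  also have "\<dots> = iterate T T' (1 + n)" using False by (auto simp: iterate_def)
  finally show ?thesis by simp
qed

lemma iterate_commute:
  assumes "S \<circ> T = T \<circ> S" "S \<circ> T' = T' \<circ> S"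
  shows "S \<circ> iterate T T' n = iterate T T' n \<circ> S"
proof -
  have "S \<circ> (U ^^ m) = (U ^^ m) \<circ> S" if "S \<circ> U = U \<circ> S" for U :: "'a \<Rightarrow> 'a" and m
    by (induction m) (use that in \<open>simp_all add: fun_eq_iff\<close>)
  then show ?thesis using assms by (simp add: iterate_def)
qed

lemma commute_inverse:
  assumes "S \<circ> T = T \<circ> S" "T \<circ> T' = id" "T' \<circ> T = id"
  shows "S \<circ> T' = T' \<circ> S"
proof -
  have "S \<circ> T' = T' \<circ> T \<circ> S \<circ> T'" by (simp add: assms(3))
  also have "\<dots> = T' \<circ> (S \<circ> T) \<circ> T'" by (simp add: assms(1) comp_assoc)
  also have "\<dots> = T' \<circ> S" using assms(2,3) by (simp add: fun_eq_iff)
  finally show ?thesis .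
qed

text \<open>
  The action of the group of dilations on the two-dimensional space. The order of the four factors is
  immaterial, as the maps commute.
\<close>

definition rho :: "dilation \<Rightarrow> vec2 \<Rightarrow> vec2" where
  "rho k = (case k of (ka, kb, kc, kz) \<Rightarrow>
     iterate T_A T_A' ka \<circ> iterate T_B T_B' kb \<circ> iterate T_C T_C' kc \<circ> iterate T_Z T_Z' kz)"

lemma rho_0: "rho 0 = id"
  by (simp add: rho_def zero_prod_def)

lemma rho_generators: "rho dil_A = T_A" "rho dil_B = T_B" "rho dil_C = T_C" "rho dil_Z = T_Z"
  by (simp_all add: rho_def dil_A_def dil_B_def dil_C_def dil_Z_def)

lemma rho_step:
  "rho (dil_A + k) = T_A \<circ> rho k" "rho (dil_B + k) = T_B \<circ> rho k"
  "rho (dil_C + k) = T_C \<circ> rho k" "rho (dil_Z + k) = T_Z \<circ> rho k"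
proof -
  obtain ka kb kc kz where k: "k = (ka, kb, kc, kz)" by (cases k)
  let ?A = "iterate T_A T_A' ka" and ?B = "iterate T_B T_B' kb" and ?C = "iterate T_C T_C' kc"
  have C: "T_A \<circ> T_C = T_C \<circ> T_A" "T_B \<circ> T_C = T_C \<circ> T_B"
    by (rule commute_inverse[OF _ T_inverse(6,5)], rule T_commute)+
  have A: "S \<circ> ?A = ?A \<circ> S" if "S \<circ> T_A = T_A \<circ> S" for S
    by (rule iterate_commute[OF that commute_inverse[OF that T_inverse(1,2)]])
  have B: "S \<circ> ?B = ?B \<circ> S" if "S \<circ> T_B = T_B \<circ> S" for S
    by (rule iterate_commute[OF that commute_inverse[OF that T_inverse(3,4)]])
  have C': "S \<circ> ?C = ?C \<circ> S" if "S \<circ> T_C = T_C \<circ> S" for S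
    by (rule iterate_commute[OF that commute_inverse[OF that T_inverse(5,6)]])
  note comm = A[OF T_commute(1)[symmetric]] A[OF C(1)[symmetric]] A[OF T_commute_Z(1)[symmetric]]
    B[OF C(2)[symmetric]] B[OF T_commute_Z(2)[symmetric]] C'[OF T_commute_Z(3)[symmetric]]
  show "rho (dil_A + k) = T_A \<circ> rho k"
    by (simp add: k rho_def dil_A_def iterate_add_1 T_inverse comp_assoc)
  show "rho (dil_B + k) = T_B \<circ> rho k"
    using comm by (simp add: k rho_def dil_B_def iterate_add_1 T_inverse fun_eq_iff del: split_paired_All)
  show "rho (dil_C + k) = T_C \<circ> rho k"
    using comm by (simp add: k rho_def dil_C_def iterate_add_1 T_inverse fun_eq_iff del: split_paired_All)
  show "rho (dil_Z + k) = T_Z \<circ> rho k"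
    using comm by (simp add: k rho_def dil_Z_def iterate_add_1 T_Z_inverse fun_eq_iff del: split_paired_All)
qed

lemma rho_step_back:
  "rho (k - dil_A) = T_A' \<circ> rho k" "rho (k - dil_B) = T_B' \<circ> rho k"
  "rho (k - dil_C) = T_C' \<circ> rho k" "rho (k - dil_Z) = T_Z' \<circ> rho k"
proof -
  have *: "rho (k - g) = T' \<circ> rho k" if "\<And>l. rho (g + l) = T \<circ> rho l" "T' \<circ> T = id" for g T T'
    using that(1)[of "k - g"] that(2) by (simp flip: comp_assoc)
  show "rho (k - dil_A) = T_A' \<circ> rho k" by (rule *[OF rho_step(1) T_inverse(2)])
  show "rho (k - dil_B) = T_B' \<circ> rho k" by (rule *[OF rho_step(2) T_inverse(4)])
  show "rho (k - dil_C) = T_C' \<circ> rho k" by (rule *[OF rho_step(3) T_inverse(6)])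
  show "rho (k - dil_Z) = T_Z' \<circ> rho k" by (rule *[OF rho_step(4) T_Z_inverse(2)])
qed

lemma rho_add: "rho (k + l) = rho k \<circ> rho l"
  by (induction k rule: lattice_induct)
    (simp_all add: rho_0 rho_step rho_step_back comp_assoc add.assoc diff_add_eq)

lemma semilinear_rho: "semilinear k (rho k)"
proof (induction k rule: lattice_induct)
  case (A' k)
  then show ?case using semilinear_comp[OF T_semilinear(5) A'] by (simp add: rho_step_back comp_def)
next
  case (B' k)
  then show ?case using semilinear_comp[OF T_semilinear(6) B'] by (simp add: rho_step_back comp_def)
next
  case (C' k)
  then show ?case using semilinear_comp[OF T_semilinear(7) C'] by (simp add: rho_step_back comp_def)
next
  case (Z' k)
  then show ?case using semilinear_comp[OF T_semilinear(8) Z'] by (simp add: rho_step_back comp_def)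
next
  case (A k)
  then show ?case using semilinear_comp[OF T_semilinear(1) A] by (simp add: rho_step comp_def)
next
  case (B k)
  then show ?case using semilinear_comp[OF T_semilinear(2) B] by (simp add: rho_step comp_def)
next
  case (C k)
  then show ?case using semilinear_comp[OF T_semilinear(3) C] by (simp add: rho_step comp_def)
next
  case (Z k)
  then show ?case using semilinear_comp[OF T_semilinear(4) Z] by (simp add: rho_step comp_def)
qed (use semilinear_id in \<open>simp add: rho_0 id_def\<close>)

text \<open>
  The image of the vector \<open>(1, 0)\<close> under an operator. The kernel is a left ideal that contains the
  generators of \<open>ideal_I'\<close>, so that independence modulo the ideal can be tested on these images.
\<close>

definition at_base :: "qop \<Rightarrow> vec2" where
  "at_base D = (\<Sum>P\<in>Poly_Mapping.keys D. scale (Poly_Mapping.lookup D P) (rho P (1, 0)))"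

lemma at_base_add: "at_base (S + T) = at_base S + at_base T"
  unfolding at_base_def by (rule setsum_keys_plus_distrib) (simp_all add: scale_add)

lemma at_base_0 [simp]: "at_base 0 = 0"
  by (simp add: at_base_def)

lemma at_base_single: "at_base (r \<cdot> P) = scale r (rho P (1, 0))"
  by (simp add: at_base_def)

lemma at_base_minus: "at_base (- S) = - at_base S"
  using at_base_add[of S "- S"] by (simp add: eq_neg_iff_add_eq_0 add.commute)

lemma at_base_diff: "at_base (S - T) = at_base S - at_base T"
  using at_base_add[of S "- T"] by (simp add: at_base_minus)

lemma at_base_sum: "at_base (\<Sum>i\<in>I. f i) = (\<Sum>i\<in>I. at_base (f i))"
  by (induction I rule: infinite_finite_induct) (simp_all add: at_base_add)

lemma rho_linear: "rho P (u + w) = rho P u + rho P w" "rho P (scale r u) = scale (act P r) (rho P u)"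
  using semilinear_add[OF semilinear_rho] semilinear_scale[OF semilinear_rho] by blast+

lemma rho_zero [simp]: "rho P 0 = 0"
  using rho_linear(2)[of P 0 0] by simp

lemma rho_sum: "rho P (\<Sum>i\<in>I. f i) = (\<Sum>i\<in>I. rho P (f i))"
  by (induction I rule: infinite_finite_induct) (simp_all add: rho_linear)

lemma scale_sum: "scale r (\<Sum>i\<in>I. f i) = (\<Sum>i\<in>I. scale r (f i))"
  by (induction I rule: infinite_finite_induct) (simp_all add: scale_add)

lemma at_base_mult:
  "at_base (S \<star> T) = (\<Sum>P\<in>Poly_Mapping.keys S. scale (Poly_Mapping.lookup S P) (rho P (at_base T)))"
  unfolding qop_mult_def
  by (simp add: at_base_sum at_base_single at_base_def[of T] rho_sum scale_sum scale_scale rho_linear rho_add)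

lemma left_ideal_annihilator: "left_ideal {D. at_base D = 0}"
  unfolding left_ideal_def by (simp add: at_base_add at_base_minus at_base_mult)

lemma rho_negative_generators:
  "rho (- dil_A) = T_A'" "rho (- dil_B) = T_B'" "rho (- dil_C) = T_C'" "rho (- dil_Z) = T_Z'"
  using rho_step_back[of 0] by (simp_all add: rho_0)

lemma generators_annihilate:
  "at_base gen_Pa = 0" "at_base gen_Pb = 0" "at_base gen_Pc = 0" "at_base gen_Qa = 0"
  "at_base gen_Qb = 0" "at_base gen_Qc = 0" "at_base gen_Rz = 0"
  unfolding gen_Pa_def gen_Pb_def gen_Pc_def gen_Qa_def gen_Qb_def gen_Qc_def gen_Rz_def
    at_base_add at_base_diff at_base_single rho_generators rho_negative_generators rho_0
    T_A_def T_B_def T_C_def T_A'_def T_B'_def T_C'_def T_Z'_def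
  by (simp add: zero_prod_def; simp add: field_simps power2_eq_square)+

lemma ideal_annihilates: "S \<in> ideal_I' \<Longrightarrow> at_base S = 0"
  using ideal_I'_least[OF _ left_ideal_annihilator, of S] generators_annihilate by simp

section \<open>Distinct dilations are independent modulo the ideal\<close>

lemma vq_powi_eq_iff: "vq powi m = vq powi n \<longleftrightarrow> m = n"
proof
  have pos: "vq ^ n \<noteq> 1" if "n > 0" for n
  proof
    assume "vq ^ n = 1"
    then have "to_fract ([:[:[:[:[:0, 1:]:]:]:]:] ^ n) = to_fract (1 :: poly5)"
      by (simp add: vq_def to_fract_power)
    then have "[:[:[:[:[:0, 1:]:]:]:]:] ^ n = (1 :: poly5)"
      by (simp only: to_fract_eq_iff)
    then have "[:0, 1:] ^ n = (1 :: complex poly)"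
      by (simp add: poly_const_pow one_pCons)
    then have "poly ([:0, 1:] ^ n) 0 = (1 :: complex)" by simp
    with that show False by (simp add: zero_power)
  qed
  assume "vq powi m = vq powi n"
  then have 1: "vq powi (m - n) = 1" "vq powi (n - m) = 1" by (simp_all add: power_int_diff)
  show "m = n"
  proof (rule ccontr)
    assume "m \<noteq> n"
    then consider "m > n" | "n > m" by linarith
    then show False
      using 1 pos[of "nat (m - n)"] pos[of "nat (n - m)"] by cases (simp_all add: power_int_def)
  qed
qed simp

text \<open>
  If \<open>W\<close> multiplies the class of \<open>1\<close> by \<open>t\<close>, then it multiplies the class of \<open>Z\<close> by \<open>Z(t)\<close>, because
  \<open>W\<close> and \<open>Z\<close> commute. So \<open>W\<close> is diagonal in the basis \<open>1\<close>, \<open>Z\<close>. Comparing \<open>W g\<close> with \<open>g W\<close> for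
  a dilation \<open>g\<close> of the class \<open>x + y Z\<close> gives \<open>W(x) t = g(t) x\<close> and \<open>W(y) Z(t) = g(t) y\<close>, and \<open>g(t)\<close> can be eliminated.
\<close>

lemma scalar_dilation_eigen:
  assumes W: "rho W (1, 0) = scale t (1, 0)" and g: "rho g (1, 0) = (x, y)"
  shows "act W x * t * y = act W y * act dil_Z t * x"
proof -
  have WZ: "rho W (0, 1) = (0, act dil_Z t)"
  proof -
    have "rho W (0, 1) = rho W (rho dil_Z (1, 0))" by (simp add: rho_generators)
    also have "\<dots> = rho dil_Z (rho W (1, 0))" using rho_add[of W dil_Z] rho_add[of dil_Z W]
      by (metis add.commute comp_apply)
    also have "\<dots> = (0, act dil_Z t)" unfolding W rho_linear by (simp add: rho_generators)
    finally show ?thesis .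
  qed
  have "(x, y) = scale x (1, 0) + scale y (0, 1)" by simp
  then have "rho W (rho g (1, 0)) = scale (act W x) (rho W (1, 0)) + scale (act W y) (rho W (0, 1))"
    unfolding g by (simp only: rho_linear)
  also have "\<dots> = (act W x * t, act W y * act dil_Z t)" by (simp add: W WZ)
  also have "rho W (rho g (1, 0)) = rho g (rho W (1, 0))"
    using rho_add[of W g] rho_add[of g W] by (metis add.commute comp_apply)
  also have "\<dots> = (act g t * x, act g t * y)" unfolding W rho_linear g by simp
  finally have "act W x * t = act g t * x" "act W y * act dil_Z t = act g t * y" by simp_all
  then show ?thesis by (simp add: mult_ac)
qed

text \<open>
  The preceding relation for \<open>A\<close>, \<open>B\<close> and the inverse of \<open>C\<close> says that \<open>t / Z(t)\<close> equals \<open>q\<close> to the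
  power \<open>ka\<close>, \<open>kb\<close> and \<open>kc\<close>, so these exponents agree. The relation for the inverse of \<open>Z\<close> is then an
  equation in \<open>a\<close>, \<open>b\<close>, \<open>c\<close>, \<open>z\<close> and the two powers \<open>Q\<close> and \<open>S\<close> of \<open>q\<close>, and its coefficients force
  \<open>Q = S = 1\<close>.
\<close>

lemma scalar_dilation_trivial:
  assumes W: "rho W (1, 0) = scale t (1, 0)"
  shows "W = 0"
proof -
  obtain ka kb kc kz where k: "W = (ka, kb, kc, kz)" by (cases W)
  define s where "s = act dil_Z t"
  have t: "t \<noteq> 0"
  proof
    assume "t = 0"
    then have "rho (- W) (rho W (1, 0)) = 0" by (simp add: W del: scale_simps(1))
    moreover have "rho (- W) (rho W (1, 0)) = (1, 0)"
      using fun_cong[OF rho_add[of "- W" W], of "(1, 0)"] by (simp add: rho_0)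
    ultimately show False by (simp add: zero_prod_def)
  qed
  then have s: "s \<noteq> 0" by (simp add: s_def)
  note eigen = scalar_dilation_eigen[OF W, folded s_def]
  have nz: "1 \<noteq> va * vq powi ka" "1 \<noteq> vb * vq powi kb" "vq \<noteq> vc * vq powi kc" "vq \<noteq> vz * vq powi kz"
    using act_eq_0_iff[of W "1 - va"] act_eq_0_iff[of W "1 - vb"] act_eq_0_iff[of W "vq - vc"]
      act_eq_0_iff[of W "vq - vz"]
    by (simp_all add: k)
  have "rho dil_A (1, 0) = (1 / (1 - va), - va / (1 - va))"
    "rho dil_B (1, 0) = (1 / (1 - vb), - vb / (1 - vb))"
    "rho (- dil_C) (1, 0) = (vq / (vq - vc), - vc / (vq - vc))"
    "rho (- dil_Z) (1, 0) = ((vc + vq - va * vz - vb * vz) / (vq - vz), (va * vb * vz - vc) / (vq - vz))"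
    by (simp_all add: rho_generators rho_negative_generators T_A_def T_B_def T_C'_def T_Z'_def)
  note eigens = this[THEN eigen]
  have ta: "t = vq powi ka * s" and tb: "t = vq powi kb * s" and tc: "t = vq powi kc * s"
    using eigens(1-3) nz by (simp_all add: k divide_simps)
  have kk: "ka = kb" "kc = kb" using ta tb tc s vq_powi_eq_iff by auto
  define Q S where "Q = vq powi kb" and "S = vq powi kz"
  \<comment> \<open>Constant term and linear coefficient of the last relation as a polynomial in \<open>z\<close>; the
    quadratic terms cancel.\<close>
  define X Y where "X = vc^2 * (1 - Q)" and "Y = va * vb * (vc * Q * (1 - S) - vq * (Q * S - 1)) + (va + vb) * vc * (Q * S - 1)"
  have "(vc * Q + vq - va * Q * (vz * S) - vb * Q * (vz * S)) * t * (va * vb * vz - vc) =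
     (va * Q * (vb * Q) * (vz * S) - vc * Q) * s * (vc + vq - va * vz - vb * vz)"
    using eigens(4) nz
    by (simp add: k kk Q_def S_def divide_simps)
  then have "s * Q * (X + vz * Y) = 0"
    unfolding X_def Y_def tb Q_def[symmetric] by algebra
  then have XY: "X + vz * Y = 0" using s by (simp add: Q_def)
  \<comment> \<open>Dilating \<open>z\<close> separates the two coefficients.\<close>
  then have "act dil_Z (X + vz * Y) = 0" by simp
  then have "X + vz * vq * Y = 0" by (simp add: X_def Y_def Q_def S_def)
  with XY have "(vq - 1) * X = 0" by algebra
  then have "Q = 1" by (simp add: X_def)
  then have kb: "kb = 0" using vq_powi_eq_iff[of kb 0] by (simp add: Q_def)
  from XY \<open>Q = 1\<close> have "Y = 0" by (simp add: X_def)
  moreover have "Y = (S - 1) * ((va + vb) * vc - va * vb * vc - va * vb * vq)"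
    unfolding Y_def \<open>Q = 1\<close> by (simp add: algebra_simps)
  moreover have "(va + vb) * vc - va * vb * vc - va * vb * vq \<noteq> 0"
    by (simp add: va_def vb_def vc_def vq_def vz_def one_pCons flip: to_fract_1 to_fract_mult to_fract_add to_fract_diff)
  ultimately have "S = 1" by simp
  then have "kz = 0" using vq_powi_eq_iff[of kz 0] by (simp add: S_def)
  then show ?thesis using kb kk by (simp add: k zero_prod_def)
qed


text \<open>
  Applying the inverse of \<open>Y\<close> turns a relation between the classes of \<open>X\<close> and \<open>Y\<close> into the statement
  that the class of a single non-trivial dilation is a multiple of the class of \<open>1\<close>.
\<close>

lemma dilations_independent:
  assumes "X \<noteq> Y" "r \<cdot> X + s \<cdot> Y \<in> ideal_I'"
  shows "r = 0 \<and> s = 0"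
proof -
  have sum: "scale r (rho X (1, 0)) + scale s (rho Y (1, 0)) = 0"
    using ideal_annihilates[OF assms(2)] by (simp add: at_base_add at_base_single)
  have nz: "u = 0" if "scale u (rho P (1, 0)) = 0" for u P
  proof -
    have "rho (- P) (scale u (rho P (1, 0))) = 0" using that by simp
    moreover have "rho (- P) (rho P (1, 0)) = (1, 0)"
      using fun_cong[OF rho_add[of "- P" P], of "(1, 0)"] by (simp add: rho_0)
    ultimately show ?thesis by (simp add: rho_linear zero_prod_def)
  qed
  have "r = 0"
  proof (rule ccontr)
    assume r: "r \<noteq> 0"
    have "rho X (1, 0) = scale (inverse r) (scale r (rho X (1, 0)))" using r by (simp add: scale_scale)
    also have "scale r (rho X (1, 0)) = scale (- s) (rho Y (1, 0))"
      using sum by (simp add: eq_neg_iff_add_eq_0 scale_def prod_eq_iff)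
    finally have "rho X (1, 0) = scale (inverse r * - s) (rho Y (1, 0))" by (simp only: scale_scale)
    then have "rho (- Y) (rho X (1, 0)) = scale (act (- Y) (inverse r * - s)) (rho (- Y) (rho Y (1, 0)))"
      by (simp only: rho_linear)
    then have "rho (- Y + X) (1, 0) = scale (act (- Y) (inverse r * - s)) (rho (- Y + Y) (1, 0))"
      unfolding rho_add comp_apply .
    then have "- Y + X = 0" by (intro scalar_dilation_trivial) (simp add: rho_0)
    with assms(1) show False by simp
  qed
  with sum nz[of s Y] show ?thesis by simp
qed

section \<open>Three-term relations\<close>

text \<open>
  Three vectors in a plane are dependent, with the pairwise determinants as coefficients, and
  independence of each pair makes these determinants non-zero.
\<close>

lemma three_term_relation:
  assumes "X1 \<noteq> X2" "X1 \<noteq> X3" "X2 \<noteq> X3"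
  obtains r1 r2 r3 where "r1 \<noteq> 0" "r2 \<noteq> 0" "r3 \<noteq> 0" "r1 \<cdot> X1 + r2 \<cdot> X2 + r3 \<cdot> X3 \<in> ideal_I'"
proof -
  obtain u w where red: "\<And>X. 1 \<cdot> X - (u X \<cdot> 0 + w X \<cdot> dil_Z) \<in> ideal_I'"
    using reducible_dilation unfolding reducible_def by metis
  have scaled: "r \<cdot> X - ((r * u X) \<cdot> 0 + (r * w X) \<cdot> dil_Z) \<in> ideal_I'" for r X
    using ideal_closed(4)[OF red[of X], of "r \<cdot> 0"]
    by (simp add: qop_mult_diff_right qop_mult_add_right qop_mult_single)
  define det where "det X Y = u X * w Y - w X * u Y" for X Y
  have det: "det X Y \<noteq> 0" if "X \<noteq> Y" for X Y
  proof
    assume 0: "det X Y = 0"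
    have "w Y \<cdot> X - w X \<cdot> Y \<in> ideal_I'" "u Y \<cdot> X - u X \<cdot> Y \<in> ideal_I'"
      using ideal_diff[OF scaled[of X "w Y"] scaled[of Y "w X"]]
        ideal_diff[OF scaled[of X "u Y"] scaled[of Y "u X"]] 0
      by (simp_all add: det_def mult.commute)
    then have "w Y = 0" "u Y = 0"
      using dilations_independent[OF that, of _ "- w X"] dilations_independent[OF that, of _ "- u X"]
      by (simp_all add: single_uminus)
    then have "0 \<cdot> X + 1 \<cdot> Y \<in> ideal_I'" using red[of Y] by simp
    then show False using dilations_independent[OF that] by fastforce
  qed
  let ?r1 = "det X2 X3" and ?r2 = "- det X1 X3" and ?r3 = "det X1 X2"
  have "?r1 * u X1 + ?r2 * u X2 + ?r3 * u X3 = 0" "?r1 * w X1 + ?r2 * w X2 + ?r3 * w X3 = 0"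
    by (simp_all add: det_def algebra_simps)
  note cramer = arg_cong[OF this(1), of "\<lambda>x. x \<cdot> 0"] arg_cong[OF this(2), of "\<lambda>x. x \<cdot> dil_Z"]
  have "?r1 \<cdot> X1 - ((?r1 * u X1) \<cdot> 0 + (?r1 * w X1) \<cdot> dil_Z) + (?r2 \<cdot> X2 - ((?r2 * u X2) \<cdot> 0 + (?r2 * w X2) \<cdot> dil_Z))
     + (?r3 \<cdot> X3 - ((?r3 * u X3) \<cdot> 0 + (?r3 * w X3) \<cdot> dil_Z)) \<in> ideal_I'"
    by (intro ideal_closed(2) scaled)
  also have "?r1 \<cdot> X1 - ((?r1 * u X1) \<cdot> 0 + (?r1 * w X1) \<cdot> dil_Z) + (?r2 \<cdot> X2 - ((?r2 * u X2) \<cdot> 0 + (?r2 * w X2) \<cdot> dil_Z))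
     + (?r3 \<cdot> X3 - ((?r3 * u X3) \<cdot> 0 + (?r3 * w X3) \<cdot> dil_Z)) =
     ?r1 \<cdot> X1 + ?r2 \<cdot> X2 + ?r3 \<cdot> X3 - (?r1 * u X1 + ?r2 * u X2 + ?r3 * u X3) \<cdot> 0
     - (?r1 * w X1 + ?r2 * w X2 + ?r3 * w X3) \<cdot> dil_Z"
    by (simp only: single_add) (simp only: algebra_simps)
  finally have "?r1 \<cdot> X1 + ?r2 \<cdot> X2 + ?r3 \<cdot> X3 \<in> ideal_I'" by (simp only: cramer single_zero diff_zero)
  then show ?thesis using det assms by (intro that[of ?r1 ?r2 ?r3]) simp_all
qed

theorem proposition2p4:
  fixes X1 X2 X3 :: dilation
  assumes "X1 \<noteq> X2" and "X1 \<noteq> X3" and "X2 \<noteq> X3"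
  shows "(\<exists>p1 p2 p3 :: poly5. p1 \<noteq> 0 \<and> p2 \<noteq> 0 \<and> p3 \<noteq> 0 \<and>
            to_fract p1 \<cdot> X1 + to_fract p2 \<cdot> X2 + to_fract p3 \<cdot> X3 \<in> ideal_I') \<and>
         (\<forall>p1 p2 p3 p1' p2' p3' :: poly5.
            p1 \<noteq> 0 \<and> p2 \<noteq> 0 \<and> p3 \<noteq> 0 \<and>
            to_fract p1 \<cdot> X1 + to_fract p2 \<cdot> X2 + to_fract p3 \<cdot> X3 \<in> ideal_I' \<and>
            p1' \<noteq> 0 \<and> p2' \<noteq> 0 \<and> p3' \<noteq> 0 \<and>
            to_fract p1' \<cdot> X1 + to_fract p2' \<cdot> X2 + to_fract p3' \<cdot> X3 \<in> ideal_I' \<longrightarrow>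
            (\<exists>r :: rat5. to_fract p1' = r * to_fract p1 \<and> to_fract p2' = r * to_fract p2 \<and>
                         to_fract p3' = r * to_fract p3))"
proof (intro conjI allI impI)
  obtain r1 r2 r3 where r: "r1 \<noteq> 0" "r2 \<noteq> 0" "r3 \<noteq> 0"
    and rel: "r1 \<cdot> X1 + r2 \<cdot> X2 + r3 \<cdot> X3 \<in> ideal_I'"
    using three_term_relation[OF assms] .
  obtain n1 d1 where 1: "d1 \<noteq> 0" "r1 = to_fract n1 / to_fract d1" by (rule fraction_cases)
  obtain n2 d2 where 2: "d2 \<noteq> 0" "r2 = to_fract n2 / to_fract d2" by (rule fraction_cases)
  obtain n3 d3 where 3: "d3 \<noteq> 0" "r3 = to_fract n3 / to_fract d3" by (rule fraction_cases)
  let ?d = "to_fract (d1 * d2 * d3)"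
  have "?d * r1 = to_fract (n1 * d2 * d3)" "?d * r2 = to_fract (d1 * n2 * d3)" "?d * r3 = to_fract (d1 * d2 * n3)"
    using 1 2 3 by simp_all
  then have "to_fract (n1 * d2 * d3) \<cdot> X1 + to_fract (d1 * n2 * d3) \<cdot> X2 + to_fract (d1 * d2 * n3) \<cdot> X3 \<in> ideal_I'"
    using ideal_closed(4)[OF rel, of "?d \<cdot> 0"]
    by (simp only: qop_mult_add_right qop_mult_single act_0 add_0)
  moreover have "n1 * d2 * d3 \<noteq> 0" "d1 * n2 * d3 \<noteq> 0" "d1 * d2 * n3 \<noteq> 0" using 1 2 3 r by auto
  ultimately show "\<exists>p1 p2 p3 :: poly5. p1 \<noteq> 0 \<and> p2 \<noteq> 0 \<and> p3 \<noteq> 0 \<and>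
      to_fract p1 \<cdot> X1 + to_fract p2 \<cdot> X2 + to_fract p3 \<cdot> X3 \<in> ideal_I'"
    by blast
next
  fix p1 p2 p3 p1' p2' p3' :: poly5
  assume asm: "p1 \<noteq> 0 \<and> p2 \<noteq> 0 \<and> p3 \<noteq> 0 \<and>
            to_fract p1 \<cdot> X1 + to_fract p2 \<cdot> X2 + to_fract p3 \<cdot> X3 \<in> ideal_I' \<and>
            p1' \<noteq> 0 \<and> p2' \<noteq> 0 \<and> p3' \<noteq> 0 \<and>
            to_fract p1' \<cdot> X1 + to_fract p2' \<cdot> X2 + to_fract p3' \<cdot> X3 \<in> ideal_I'"
  define r where "r = to_fract p1' / to_fract p1"
  have r: "to_fract p1' = r * to_fract p1" using asm by (simp add: r_def)
  have "(r * to_fract p1) \<cdot> X1 + (r * to_fract p2) \<cdot> X2 + (r * to_fract p3) \<cdot> X3 \<in> ideal_I'"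
    using ideal_closed(4)[of "to_fract p1 \<cdot> X1 + to_fract p2 \<cdot> X2 + to_fract p3 \<cdot> X3" "r \<cdot> 0"] asm
    by (simp add: qop_mult_add_right qop_mult_single)
  from ideal_diff[OF _ this, of "to_fract p1' \<cdot> X1 + to_fract p2' \<cdot> X2 + to_fract p3' \<cdot> X3"] asm
  have "(to_fract p2' - r * to_fract p2) \<cdot> X2 + (to_fract p3' - r * to_fract p3) \<cdot> X3 \<in> ideal_I'"
    by (simp add: r single_diff algebra_simps)
  from dilations_independent[OF assms(3) this] r
  show "\<exists>r :: rat5. to_fract p1' = r * to_fract p1 \<and> to_fract p2' = r * to_fract p2 \<and>
                         to_fract p3' = r * to_fract p3"
    by (intro exI[of _ r]) simp
qed

end
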